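(* Suppose $\liminf_{n\to\infty}\beta_n>1$ and there exist infinitely many $n\ge1$ satisfying $\Delta_{n-1}\Delta_n>0$. Then $\lim_{n\to\infty}\Delta_n=0$.
   Context: For real $x$ let $[x]$ be the greatest integer $\le x$ and $\{x\}=x-[x]$. Let $(\alpha_0,\beta_0)\in\mathbf{R}^2$ with $0\le\alpha_0\le\beta_0$, $1\le\beta_0$, and assume $1,\alpha_0,\beta_0$ are linearly independent over $\mathbf{Q}$. The Jacobi-Perron algorithm (dimension 2) defines, for $n\ge1$, $\alpha_n=\{\beta_{n-1}\}/\{\alpha_{n-1}\}$ and $\beta_n=1/\{\alpha_{n-1}\}$ (under the independence assumption all $\{\alpha_n\},\{\beta_n\}$ are nonzero, so this is defined for all $n$). Put $a_n=[\alpha_n]$, $b_n=[\beta_n]$ for $n\ge0$. Define $(r_{-2},r_{-1},r_0)=(0,0,1)$, $(p_{-2},p_{-1},p_0)=(1,0,a_0)$, $(q_{-2},q_{-1},q_0)=(0,1,b_0)$, and for $n\ge1$: $r_n=r_{n-1}b_n+r_{n-2}a_n+r_{n-3}$, $p_n=p_{n-1}b_n+p_{n-2}a_n+p_{n-3}$, $q_n=q_{n-1}b_n+q_{n-2}a_n+q_{n-3}$. Set $\Delta_n=p_n-\alpha_0 r_n$ for $n\ge0$. *)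

theory Defs
  imports "HOL-Library.Extended_Real" "HOL-Library.Liminf_Limsup"
begin

definition lin_indep_one_over_rat :: "real \<Rightarrow> real \<Rightarrow> bool" where
  "lin_indep_one_over_rat x y \<longleftrightarrow>
     (\<forall>u v w :: rat. of_rat u * 1 + of_rat v * x + of_rat w * y = (0::real) \<longrightarrow>
        u = 0 \<and> v = 0 \<and> w = 0)"

text \<open>The Jacobi-Perron expansion of \<open>(x, y)\<close>. If \<open>1, x, y\<close> are linearly independent
  over the rationals, the denominators below are never zero, so the convention \<open>t / 0 = 0\<close>
  plays no role.\<close>

fun jp_alpha :: "real \<Rightarrow> real \<Rightarrow> nat \<Rightarrow> real"
  and jp_beta :: "real \<Rightarrow> real \<Rightarrow> nat \<Rightarrow> real" where
  "jp_alpha x y 0 = x"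
| "jp_alpha x y (Suc n) = frac (jp_beta x y n) / frac (jp_alpha x y n)"
| "jp_beta x y 0 = y"
| "jp_beta x y (Suc n) = 1 / frac (jp_alpha x y n)"

definition jp_a :: "real \<Rightarrow> real \<Rightarrow> nat \<Rightarrow> int" where
  "jp_a x y n = \<lfloor>jp_alpha x y n\<rfloor>"

definition jp_b :: "real \<Rightarrow> real \<Rightarrow> nat \<Rightarrow> int" where
  "jp_b x y n = \<lfloor>jp_beta x y n\<rfloor>"

text \<open>A solution \<open>s\<close>, indexed from \<open>-2\<close>, of
  \<open>s n = s (n - 1) * b n + s (n - 2) * a n + s (n - 3)\<close> for \<open>n \<ge> 1\<close>, with
  \<open>s (-2) = u\<close>, \<open>s (-1) = v\<close>, \<open>s 0 = w\<close>. The index is shifted by two: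
  \<open>jp_rec a b u v w k\<close> is \<open>s (k - 2)\<close>.\<close>

fun jp_rec :: "(nat \<Rightarrow> int) \<Rightarrow> (nat \<Rightarrow> int) \<Rightarrow> int \<Rightarrow> int \<Rightarrow> int \<Rightarrow> nat \<Rightarrow> int" where
  "jp_rec a b u v w 0 = u"
| "jp_rec a b u v w (Suc 0) = v"
| "jp_rec a b u v w (Suc (Suc 0)) = w"
| "jp_rec a b u v w (Suc (Suc (Suc m))) =
     jp_rec a b u v w (Suc (Suc m)) * b (Suc m) + jp_rec a b u v w (Suc m) * a (Suc m)
     + jp_rec a b u v w m"

definition jp_r :: "real \<Rightarrow> real \<Rightarrow> nat \<Rightarrow> int" where
  "jp_r x y n = jp_rec (jp_a x y) (jp_b x y) 0 0 1 (n + 2)"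

definition jp_p :: "real \<Rightarrow> real \<Rightarrow> nat \<Rightarrow> int" where
  "jp_p x y n = jp_rec (jp_a x y) (jp_b x y) 1 0 (jp_a x y 0) (n + 2)"

definition jp_Delta :: "real \<Rightarrow> real \<Rightarrow> nat \<Rightarrow> real" where
  "jp_Delta x y n = of_int (jp_p x y n) - x * of_int (jp_r x y n)"

end

theory Submission
  imports Defs
begin

text \<open>
  The defects \<open>\<Delta>\<^sub>n\<close> satisfy \<open>\<beta>\<^sub>n\<^sub>+\<^sub>1 \<Delta>\<^sub>n + \<alpha>\<^sub>n\<^sub>+\<^sub>1 \<Delta>\<^sub>n\<^sub>-\<^sub>1 + \<Delta>\<^sub>n\<^sub>-\<^sub>2 = 0\<close>, because \<open>(\<alpha>\<^sub>n\<^sub>+\<^sub>1, \<beta>\<^sub>n\<^sub>+\<^sub>1)\<close> is the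
  exact tail of the expansion (\<open>jp_defect_relation\<close>). Subtracting this from the recurrence
  for \<open>\<Delta>\<^sub>n\<^sub>+\<^sub>1\<close> leaves \<open>\<Delta>\<^sub>n\<^sub>+\<^sub>1 = - {\<beta>\<^sub>n\<^sub>+\<^sub>1} \<Delta>\<^sub>n - {\<alpha>\<^sub>n\<^sub>+\<^sub>1} \<Delta>\<^sub>n\<^sub>-\<^sub>1\<close>.

  Let \<open>M\<close> be the maximum of \<open>\<bar>\<Delta>\<bar>\<close> over three consecutive indices. It never increases
  (\<open>abs_next_defect_le\<close>): if \<open>\<Delta>\<^sub>n\<^sub>-\<^sub>1\<close> and \<open>\<Delta>\<^sub>n\<close> do not have the same sign, the two terms of
  \<open>\<Delta>\<^sub>n\<^sub>+\<^sub>1\<close> partly cancel; if they do, \<open>\<Delta>\<^sub>n\<^sub>-\<^sub>2\<close> has the opposite sign, and adding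
  \<open>[\<beta>\<^sub>n\<^sub>+\<^sub>1] \<Delta>\<^sub>n + [\<alpha>\<^sub>n\<^sub>+\<^sub>1] \<Delta>\<^sub>n\<^sub>-\<^sub>1\<close> to it to get \<open>\<Delta>\<^sub>n\<^sub>+\<^sub>1\<close> only brings it closer to zero.

  In the second case there is a definite gain (\<open>abs_defects_contract\<close>). Let \<open>c < 1\<close> bound the
  fractional parts \<open>{\<alpha>\<^sub>n} = 1 / \<beta>\<^sub>n\<^sub>+\<^sub>1\<close> for large \<open>n\<close>; such a \<open>c\<close> exists because
  \<open>liminf \<beta>\<^sub>n > 1\<close>. Then \<open>\<bar>\<Delta>\<^sub>n\<^sub>+\<^sub>1\<bar>\<close> is at most \<open>M - \<bar>\<Delta>\<^sub>n\<bar>\<close> and also at most \<open>\<bar>\<Delta>\<^sub>n\<bar> + c M\<close>,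
  hence at most the mean \<open>(1 + c) / 2 * M\<close> of the two bounds, and \<open>\<bar>\<Delta>\<^sub>n\<bar> \<le> \<bar>\<Delta>\<^sub>n\<^sub>-\<^sub>2\<bar> / \<beta>\<^sub>n\<^sub>+\<^sub>1 \<le> c M\<close>.
  Two steps later \<open>M\<close> has shrunk by the factor \<open>(1 + c) / 2\<close>. As this happens infinitely
  often, \<open>M\<close> tends to zero.
\<close>

section \<open>Consecutive defects\<close>

lemma abs_add_le_max_of_opposite_sign:
  fixes s t :: real
  assumes "s * t \<le> 0"
  shows "\<bar>s + t\<bar> \<le> max \<bar>s\<bar> \<bar>t\<bar>"
  using assms by (auto simp: mult_le_0_iff)

lemma abs_frac_combination_le:
  fixes u v s t :: real
  assumes "s * t \<le> 0"
  shows "\<bar>- frac u * s - frac v * t\<bar> \<le> max \<bar>s\<bar> \<bar>t\<bar>"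
proof -
  have "(frac u * s) * (frac v * t) = (frac u * frac v) * (s * t)"
    by simp
  also have "\<dots> \<le> 0"
    using assms by (intro mult_nonneg_nonpos[OF mult_nonneg_nonneg] frac_ge_0)
  finally have "\<bar>frac u * s + frac v * t\<bar> \<le> max \<bar>frac u * s\<bar> \<bar>frac v * t\<bar>"
    by (rule abs_add_le_max_of_opposite_sign)
  moreover have "\<bar>frac w * z\<bar> \<le> \<bar>z\<bar>" for w z :: real
    using frac_lt_1[of w] by (simp add: abs_mult mult_left_le_one_le)
  ultimately have "\<bar>frac u * s + frac v * t\<bar> \<le> max \<bar>s\<bar> \<bar>t\<bar>"
    by (meson max.mono order_trans)
  moreover have "- frac u * s - frac v * t = - (frac u * s + frac v * t)"
    by simp
  ultimately show ?thesis
    by (simp only: abs_minus_cancel)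
qed

text \<open>
  When \<open>d1\<close> and \<open>d2\<close> have the same sign, nothing cancels: the relation reads
  \<open>\<bar>d0\<bar> = \<beta> * \<bar>d2\<bar> + \<alpha> * \<bar>d1\<bar>\<close>, and \<open>\<bar>d3\<bar>\<close> is the same sum with \<open>\<alpha>\<close> and \<open>\<beta>\<close> replaced by
  their fractional parts. The loss is at least \<open>\<bar>d2\<bar>\<close> because \<open>\<beta>\<close> has integer part at least \<open>1\<close>.
\<close>

lemma same_sign_defects:
  fixes \<alpha> \<beta> d0 d1 d2 d3 :: real
  assumes "0 \<le> \<alpha>" "1 \<le> \<beta>"
    and rel: "\<beta> * d2 + \<alpha> * d1 + d0 = 0"
    and d3: "d3 = - frac \<beta> * d2 - frac \<alpha> * d1"
    and sign: "d1 * d2 > 0"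
  shows "\<beta> * \<bar>d2\<bar> \<le> \<bar>d0\<bar>"
    and "\<bar>d3\<bar> \<le> \<bar>d0\<bar> - \<bar>d2\<bar>"
    and "\<bar>d3\<bar> \<le> \<bar>d2\<bar> + frac \<alpha> * \<bar>d1\<bar>"
    and "d2 * d3 \<le> 0"
proof -
  have abs_comb: "\<bar>u * d2 + v * d1\<bar> = u * \<bar>d2\<bar> + v * \<bar>d1\<bar>"
    if "0 \<le> u" "0 \<le> v" for u v
  proof (cases "d1 > 0")
    case True
    then have "d2 > 0"
      using sign by (simp add: zero_less_mult_iff)
    then show ?thesis
      using True that by simp
  next
    case False
    then have "d1 < 0" "d2 < 0"
      using sign by (auto simp: zero_less_mult_iff)
    then have "u * d2 + v * d1 \<le> 0"
      using that by (intro add_nonpos_nonpos mult_nonneg_nonpos) auto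
    then show ?thesis
      using \<open>d1 < 0\<close> \<open>d2 < 0\<close> by simp
  qed
  have d0_abs: "\<bar>d0\<bar> = \<beta> * \<bar>d2\<bar> + \<alpha> * \<bar>d1\<bar>"
    using abs_comb[of \<beta> \<alpha>] assms(1,2) rel by linarith
  have "\<bar>d3\<bar> = \<bar>frac \<beta> * d2 + frac \<alpha> * d1\<bar>"
    using d3 by (simp add: abs_if algebra_simps)
  then have d3_abs: "\<bar>d3\<bar> = frac \<beta> * \<bar>d2\<bar> + frac \<alpha> * \<bar>d1\<bar>"
    using abs_comb[of "frac \<beta>" "frac \<alpha>"] by simp
  show "\<beta> * \<bar>d2\<bar> \<le> \<bar>d0\<bar>"
    using d0_abs assms(1) by simp
  have "(frac \<beta> + 1) * \<bar>d2\<bar> \<le> \<beta> * \<bar>d2\<bar>"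
    using assms(2) by (intro mult_right_mono) (auto simp: frac_def)
  moreover have "frac \<alpha> * \<bar>d1\<bar> \<le> \<alpha> * \<bar>d1\<bar>"
    using assms(1) by (intro mult_right_mono) (auto simp: frac_def)
  ultimately show "\<bar>d3\<bar> \<le> \<bar>d0\<bar> - \<bar>d2\<bar>"
    using d0_abs d3_abs by (simp add: algebra_simps)
  have "frac \<beta> * \<bar>d2\<bar> \<le> \<bar>d2\<bar>"
    using frac_lt_1[of \<beta>] by (simp add: mult_left_le_one_le)
  then show "\<bar>d3\<bar> \<le> \<bar>d2\<bar> + frac \<alpha> * \<bar>d1\<bar>"
    using d3_abs by simp
  have "d2 * d3 = - (frac \<beta> * (d2 * d2) + frac \<alpha> * (d1 * d2))"
    by (simp add: d3 algebra_simps)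
  also have "\<dots> \<le> 0"
    using sign mult_nonneg_nonneg[OF frac_ge_0[of \<beta>] zero_le_square[of d2]]
      mult_nonneg_nonneg[OF frac_ge_0[of \<alpha>] less_imp_le[OF sign]] by linarith
  finally show "d2 * d3 \<le> 0" .
qed

lemma abs_next_defect_le:
  fixes \<alpha> \<beta> d0 d1 d2 d3 :: real
  assumes "0 \<le> \<alpha>" "1 \<le> \<beta>"
    and "\<beta> * d2 + \<alpha> * d1 + d0 = 0"
    and "d3 = - frac \<beta> * d2 - frac \<alpha> * d1"
  shows "\<bar>d3\<bar> \<le> max \<bar>d0\<bar> (max \<bar>d1\<bar> \<bar>d2\<bar>)"
proof (cases "d1 * d2 > 0")
  case True
  then show ?thesis
    using same_sign_defects(2)[OF assms] by linarith
next
  case False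
  then show ?thesis
    using abs_frac_combination_le[of d2 d1 \<beta> \<alpha>, folded assms(4)]
    unfolding mult.commute[of d2 d1] by linarith
qed

text \<open>
  The two bounds on \<open>\<bar>d3\<bar>\<close> in \<open>same_sign_defects\<close> move in opposite directions as \<open>\<bar>d2\<bar>\<close> varies, so
  their mean is independent of \<open>d2\<close>. One more defect is needed to push \<open>d1\<close> out of the maximum;
  \<open>d2\<close> and \<open>d3\<close> have opposite signs, so it does not exceed the larger of the two.
\<close>

lemma abs_defects_contract:
  fixes \<alpha> \<beta> \<alpha>' \<beta>' d0 d1 d2 d3 d4 c K :: real
  assumes tail: "0 \<le> \<alpha>" "1 \<le> \<beta>" "\<beta> * d2 + \<alpha> * d1 + d0 = 0"
    and d3: "d3 = - frac \<beta> * d2 - frac \<alpha> * d1"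
    and d4: "d4 = - frac \<beta>' * d3 - frac \<alpha>' * d2"
    and sign: "d1 * d2 > 0"
    and c: "1 \<le> c * \<beta>" "frac \<alpha> \<le> c" "c \<le> 1"
    and K: "\<bar>d0\<bar> \<le> K" "\<bar>d1\<bar> \<le> K"
  shows "max \<bar>d2\<bar> (max \<bar>d3\<bar> \<bar>d4\<bar>) \<le> (1 + c) / 2 * K"
proof -
  note same = same_sign_defects[OF tail d3 sign]
  have "0 \<le> c"
    using c(2) frac_ge_0[of \<alpha>] by linarith
  have "\<bar>d2\<bar> \<le> (c * \<beta>) * \<bar>d2\<bar>"
    using c(1) mult_right_mono[of 1 "c * \<beta>" "\<bar>d2\<bar>"] by simp
  also have "\<dots> \<le> c * K"
    using same(1) K(1) \<open>0 \<le> c\<close> mult_left_mono[of "\<beta> * \<bar>d2\<bar>" K c] by (simp add: mult.assoc)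
  also have "\<dots> \<le> (1 + c) / 2 * K"
    using c(3) K(1) by (intro mult_right_mono) auto
  finally have d2_le: "\<bar>d2\<bar> \<le> (1 + c) / 2 * K" .
  have "frac \<alpha> * \<bar>d1\<bar> \<le> c * K"
    using c(2) K(2) \<open>0 \<le> c\<close> by (intro mult_mono) auto
  then have "\<bar>d3\<bar> \<le> \<bar>d2\<bar> + c * K" "\<bar>d3\<bar> \<le> K - \<bar>d2\<bar>"
    using same(2,3) K(1) by linarith+
  then have d3_le: "\<bar>d3\<bar> \<le> (1 + c) / 2 * K"
    by (simp add: field_simps)
  have "\<bar>d4\<bar> \<le> max \<bar>d3\<bar> \<bar>d2\<bar>"
    using abs_frac_combination_le[of d3 d2 \<beta>' \<alpha>'] same(4) d4 by (simp add: mult.commute)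
  also have "\<dots> \<le> (1 + c) / 2 * K"
    using d2_le d3_le by (rule max.boundedI[rotated])
  finally have "\<bar>d4\<bar> \<le> (1 + c) / 2 * K" .
  then show ?thesis
    using d2_le d3_le by (intro max.boundedI)
qed

section \<open>The exact tail of the expansion\<close>

text \<open>
  A zero denominator is permanent: division by zero gives zero, whose fractional part is zero
  again. So a lower bound on \<open>\<beta>\<^sub>n\<close> for large \<open>n\<close> rules out zero denominators at every index.
\<close>

lemma jp_vanishes_after_integer:
  assumes "frac (jp_alpha x y n) = 0"
  shows "jp_alpha x y (Suc n + k) = 0 \<and> jp_beta x y (Suc n + k) = 0"
proof (induction k)
  case 0
  show ?case using assms by simp
next
  case (Suc k)
  then have "frac (jp_alpha x y (Suc n + k)) = 0"
    by (simp del: jp_alpha.simps)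
  then show ?case
    unfolding add_Suc_right jp_alpha.simps(2) jp_beta.simps(2) by simp
qed

lemma frac_jp_alpha_pos:
  assumes "eventually (\<lambda>n. jp_beta x y n > 0) sequentially"
  shows "frac (jp_alpha x y n) > 0"
proof (rule ccontr)
  assume "\<not> frac (jp_alpha x y n) > 0"
  then have "frac (jp_alpha x y n) = 0"
    using frac_ge_0[of "jp_alpha x y n"] by linarith
  then have zero: "jp_beta x y (Suc n + k) = 0" for k
    using jp_vanishes_after_integer by blast
  obtain N where "\<And>m. m \<ge> N \<Longrightarrow> jp_beta x y m > 0"
    using assms by (auto simp: eventually_sequentially)
  then have "jp_beta x y (Suc n + N) > 0"
    by (simp del: jp_beta.simps)
  with zero[of N] show False
    by (simp del: jp_beta.simps)
qed

lemma jp_alpha_Suc_nonneg: "0 \<le> jp_alpha x y (Suc n)"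
  by simp

lemma jp_beta_Suc_gt_1:
  assumes "frac (jp_alpha x y n) > 0"
  shows "1 < jp_beta x y (Suc n)"
  using assms frac_lt_1[of "jp_alpha x y n"] by simp

text \<open>
  This is \<open>\<Delta>\<close> started two indices earlier, at \<open>\<Delta>\<^sub>-\<^sub>2 = 1\<close> and \<open>\<Delta>\<^sub>-\<^sub>1 = 0\<close>, where the exact relation
  can be read off from \<open>\<beta>\<^sub>1 = 1 / {x}\<close>.
\<close>

definition jp_defect :: "real \<Rightarrow> real \<Rightarrow> nat \<Rightarrow> real" where
  "jp_defect x y k =
     of_int (jp_rec (jp_a x y) (jp_b x y) 1 0 (jp_a x y 0) k)
     - x * of_int (jp_rec (jp_a x y) (jp_b x y) 0 0 1 k)"

lemma jp_Delta_eq_defect: "jp_Delta x y n = jp_defect x y (n + 2)"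
  by (simp add: jp_Delta_def jp_defect_def jp_p_def jp_r_def)

lemma jp_defect_rec:
  "jp_defect x y (n + 3) =
     of_int \<lfloor>jp_beta x y (Suc n)\<rfloor> * jp_defect x y (n + 2)
     + of_int \<lfloor>jp_alpha x y (Suc n)\<rfloor> * jp_defect x y (n + 1) + jp_defect x y n"
  by (simp add: jp_defect_def numeral_3_eq_3 numeral_2_eq_2 jp_a_def jp_b_def algebra_simps
      del: jp_alpha.simps jp_beta.simps)

lemma jp_defect_next:
  assumes "jp_beta x y (Suc n) * jp_defect x y (n + 2)
     + jp_alpha x y (Suc n) * jp_defect x y (n + 1) + jp_defect x y n = 0"
  shows "jp_defect x y (n + 3) =
     - frac (jp_beta x y (Suc n)) * jp_defect x y (n + 2)
     - frac (jp_alpha x y (Suc n)) * jp_defect x y (n + 1)"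
  using assms unfolding jp_defect_rec frac_def by (simp add: algebra_simps
      del: jp_alpha.simps jp_beta.simps)

text \<open>
  Multiplying \<open>jp_defect_next\<close> by \<open>\<beta>\<^sub>n\<^sub>+\<^sub>2 = 1 / {\<alpha>\<^sub>n\<^sub>+\<^sub>1}\<close> turns it into the relation at the next
  index.
\<close>

lemma jp_defect_relation:
  assumes pos: "\<And>n. frac (jp_alpha x y n) > 0"
  shows "jp_beta x y (Suc n) * jp_defect x y (n + 2)
     + jp_alpha x y (Suc n) * jp_defect x y (n + 1) + jp_defect x y n = 0"
proof (induction n)
  case 0
  have "jp_defect x y (Suc (Suc 0)) = - frac x" "jp_defect x y (Suc 0) = 0" "jp_defect x y 0 = 1"
    by (simp_all add: jp_defect_def jp_a_def frac_def)
  then show ?case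
    using pos[of 0] by (simp add: numeral_2_eq_2)
next
  case (Suc n)
  have eq: "jp_defect x y (Suc n + 2) =
     - frac (jp_beta x y (Suc n)) * jp_defect x y (Suc n + 1)
     - frac (jp_alpha x y (Suc n)) * jp_defect x y (Suc n)"
    using jp_defect_next[OF Suc.IH] by (simp add: numeral_3_eq_3 del: jp_alpha.simps jp_beta.simps)
  show ?case
    unfolding eq jp_alpha.simps(2)[of x y "Suc n"] jp_beta.simps(2)[of x y "Suc n"]
    using pos[of "Suc n"] by (simp add: field_simps del: jp_alpha.simps jp_beta.simps)
qed

section \<open>Convergence\<close>

lemma decseq_contracting_infinitely_often_tendsto_0:
  fixes M :: "nat \<Rightarrow> real"
  assumes dec: "decseq M" and nonneg: "\<And>n. 0 \<le> M n"
    and c: "0 < c" "c < 1"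
    and inf: "infinite {n. M (n + k) \<le> c * M n}"
  shows "M \<longlonglongrightarrow> 0"
proof -
  obtain L where L: "M \<longlonglongrightarrow> L" "\<And>n. L \<le> M n"
    using decseq_convergent[OF dec, of 0] nonneg by blast
  have "0 \<le> L"
    using L(1) nonneg by (intro LIMSEQ_le_const) auto
  moreover have "\<not> 0 < L"
  proof
    assume "0 < L"
    then have "L < L / c"
      using c by (simp add: field_simps)
    then have "eventually (\<lambda>n. M n < L / c) sequentially"
      using L(1) by (rule order_tendstoD(2)[rotated])
    then obtain N where N: "\<And>n. n \<ge> N \<Longrightarrow> M n < L / c"
      by (auto simp: eventually_sequentially)
    obtain n where n: "n \<ge> N" "M (n + k) \<le> c * M n"
      using inf unfolding infinite_nat_iff_unbounded_le by blast
    have "c * M n < L"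
      using N[OF n(1)] c(1) by (simp add: field_simps)
    with n(2) L(2)[of "n + k"] show False
      by linarith
  qed
  ultimately show ?thesis
    using L(1) by simp
qed

theorem theorem2p2:
  fixes \<alpha>\<^sub>0 \<beta>\<^sub>0 :: real
  assumes "0 \<le> \<alpha>\<^sub>0" and "\<alpha>\<^sub>0 \<le> \<beta>\<^sub>0" and "1 \<le> \<beta>\<^sub>0"
    and "lin_indep_one_over_rat \<alpha>\<^sub>0 \<beta>\<^sub>0"
    and "liminf (\<lambda>n. ereal (jp_beta \<alpha>\<^sub>0 \<beta>\<^sub>0 n)) > 1"
    and "infinite {n :: nat. n \<ge> 1 \<and> jp_Delta \<alpha>\<^sub>0 \<beta>\<^sub>0 (n - 1) * jp_Delta \<alpha>\<^sub>0 \<beta>\<^sub>0 n > 0}"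
  shows "jp_Delta \<alpha>\<^sub>0 \<beta>\<^sub>0 \<longlonglongrightarrow> 0"
proof -
  define \<alpha> \<beta> E where "\<alpha> = jp_alpha \<alpha>\<^sub>0 \<beta>\<^sub>0" and "\<beta> = jp_beta \<alpha>\<^sub>0 \<beta>\<^sub>0"
    and "E = jp_defect \<alpha>\<^sub>0 \<beta>\<^sub>0"
  obtain B :: real where "1 < ereal B" "ereal B < liminf (\<lambda>n. ereal (\<beta> n))"
    using ereal_dense2[OF assms(5)] by (auto simp: \<beta>_def)
  then have B: "1 < B" and ev: "eventually (\<lambda>n. B < \<beta> n) sequentially"
    by (auto dest!: less_LiminfD)
  then obtain N where N: "\<And>n. n \<ge> N \<Longrightarrow> B < \<beta> n"
    by (auto simp: eventually_sequentially)
  have "eventually (\<lambda>n. \<beta> n > 0) sequentially"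
    using ev B by (auto elim: eventually_mono)
  then have frac_pos: "frac (\<alpha> n) > 0" for n
    unfolding \<alpha>_def \<beta>_def by (rule frac_jp_alpha_pos)
  have \<alpha>_nonneg: "0 \<le> \<alpha> (Suc n)" for n
    unfolding \<alpha>_def by (rule jp_alpha_Suc_nonneg)
  have \<beta>_ge: "1 \<le> \<beta> (Suc n)" for n
    using jp_beta_Suc_gt_1 frac_pos unfolding \<alpha>_def \<beta>_def by (intro less_imp_le) blast
  have rel: "\<beta> (Suc n) * E (n + 2) + \<alpha> (Suc n) * E (n + 1) + E n = 0" for n
    using jp_defect_relation[of \<alpha>\<^sub>0 \<beta>\<^sub>0 n] frac_pos unfolding \<alpha>_def \<beta>_def E_def by blast
  have E_next: "E (n + 3) = - frac (\<beta> (Suc n)) * E (n + 2) - frac (\<alpha> (Suc n)) * E (n + 1)" for n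
    using jp_defect_next rel unfolding \<alpha>_def \<beta>_def E_def by blast

  define M where "M n = max \<bar>E n\<bar> (max \<bar>E (n + 1)\<bar> \<bar>E (n + 2)\<bar>)" for n
  have "decseq M"
  proof (rule decseq_SucI)
    fix n
    have "\<bar>E (n + 3)\<bar> \<le> M n"
      unfolding M_def by (rule abs_next_defect_le[OF \<alpha>_nonneg \<beta>_ge rel E_next])
    moreover have "\<bar>E (n + 1)\<bar> \<le> M n" "\<bar>E (n + 2)\<bar> \<le> M n"
      by (simp_all add: M_def le_max_iff_disj)
    moreover have "M (Suc n) = max \<bar>E (n + 1)\<bar> (max \<bar>E (n + 2)\<bar> \<bar>E (n + 3)\<bar>)"
      by (simp add: M_def numeral_3_eq_3)
    ultimately show "M (Suc n) \<le> M n"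
      by (simp only: max.bounded_iff)
  qed

  define c where "c = 1 / B"
  have c: "0 < c" "c < 1"
    using B by (simp_all add: c_def)
  have contract: "M (n + 2) \<le> (1 + c) / 2 * M n" if "n \<ge> N" and "E (n + 1) * E (n + 2) > 0" for n
  proof -
    have \<beta>_Suc_gt: "B < \<beta> (Suc n)" and \<beta>_Suc_Suc_gt: "B < \<beta> (Suc (Suc n))"
      using N that(1) by auto
    have "1 \<le> c * \<beta> (Suc n)"
      using \<beta>_Suc_gt B by (simp add: c_def)
    moreover have "frac (\<alpha> (Suc n)) \<le> c"
    proof -
      have "B < 1 / frac (\<alpha> (Suc n))"
        using \<beta>_Suc_Suc_gt unfolding \<alpha>_def \<beta>_def jp_beta.simps(2)[of _ _ "Suc n"] .
      then show ?thesis
        using B frac_pos[of "Suc n"] by (simp only: c_def) (simp add: field_simps)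
    qed
    moreover have "E (n + 4) = - frac (\<beta> (Suc (Suc n))) * E (n + 3) - frac (\<alpha> (Suc (Suc n))) * E (n + 2)"
      using E_next[of "Suc n"] by (simp add: eval_nat_numeral)
    ultimately have
      "max \<bar>E (n + 2)\<bar> (max \<bar>E (n + 3)\<bar> \<bar>E (n + 4)\<bar>) \<le> (1 + c) / 2 * M n"
      using c(2) by (intro abs_defects_contract[OF \<alpha>_nonneg \<beta>_ge rel E_next _ that(2)])
        (auto simp: M_def)
    then show ?thesis
      by (simp add: M_def eval_nat_numeral)
  qed

  have Delta_eq: "jp_Delta \<alpha>\<^sub>0 \<beta>\<^sub>0 n = E (n + 2)" for n
    by (simp add: jp_Delta_eq_defect E_def)
  have "infinite {n. M (n + 2) \<le> (1 + c) / 2 * M n}"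
    unfolding infinite_nat_iff_unbounded_le
  proof
    fix m
    obtain n where n: "n \<ge> max m N + 1" "jp_Delta \<alpha>\<^sub>0 \<beta>\<^sub>0 (n - 1) * jp_Delta \<alpha>\<^sub>0 \<beta>\<^sub>0 n > 0"
      using assms(6) unfolding infinite_nat_iff_unbounded_le by blast
    \<comment> \<open>\<open>E\<close> runs two indices ahead of \<open>\<Delta>\<close>, so the pair \<open>(n - 1, n)\<close> for \<open>\<Delta>\<close> is \<open>(n + 1, n + 2)\<close> for \<open>E\<close>.\<close>
    have "E (n + 1) * E (n + 2) > 0"
      using n unfolding Delta_eq by simp
    then have "M (n + 2) \<le> (1 + c) / 2 * M n"
      using contract n(1) by simp
    then show "\<exists>n\<ge>m. n \<in> {n. M (n + 2) \<le> (1 + c) / 2 * M n}"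
      using n(1) by (intro exI[of _ n]) auto
  qed
  moreover have "0 \<le> M n" for n
    by (simp add: M_def)
  ultimately have "M \<longlonglongrightarrow> 0"
    using c \<open>decseq M\<close>
    by (intro decseq_contracting_infinitely_often_tendsto_0[where c = "(1 + c) / 2" and k = 2]) auto
  then show ?thesis
    by (rule tendsto_0_le[where K = 1]) (simp add: M_def Delta_eq le_max_iff_disj)
qed

end
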